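(* Let $n\ge 2$, let $(q,m)$ be a non balanced planar central configuration in the plane $\Pi=\{z=0\}\subset\mathbb{R}^3$, and suppose that the primaries are in a homographic motion $x_j(t)=r(t)Q(\theta(t))q_j$, $j=1,\dots,n$. Assume that the massless particle is moving on the $z$-axis with position vector $x_0(t)=(0,0,z(t))$, subject to the gravitational attraction of the primaries. Let $s_i=|q_i|$. Then at least one of the following statements is satisfied: 1. The massless particle is in a stationary motion, $z(t)\equiv0$, and $$\sum_{i=1}^n\frac{m_iq_i}{s_i^3}=0,$$ i.e. the positions $0,q_1,\dots,q_n$ and the masses $0,m_1,\dots,m_n$ are in a central configuration. 2. The $(n+1)$-body system is in a homothetic motion, i.e. $\theta(t)$ is constant (so that, after a fixed rotation of the configuration, $Q(\theta(t))$ is the identity matrix) and $z(t)=c\,r(t)$ for some constant $c$. Moreover, the configuration $q_0,q_1,\dots,q_n$ is a pyramidal central configuration, where $q_0=(0,0,c)$ and $m_0=0$.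
   Context: The masses $m_1,\dots,m_n$ are positive, $q_1,\dots,q_n$ are pairwise distinct, center of mass at the origin, gravitational constant $1$. Central configuration (CC) with constant $\lambda$: for positive masses, $\nabla_jU(q)+\lambda m_jq_j=0$ for all $j$, where $U(q)=\sum_{i<j}\frac{m_im_j}{|q_i-q_j|}$; equivalently $\sum_{i\neq j}\frac{m_i(q_i-q_j)}{|q_i-q_j|^3}=-\lambda q_j$ for all $j$. When some masses are zero, a CC is defined by this second form, required for all $j$ (including the massless bodies) with a common $\lambda$. Balanced: for every $r>0$ such that $F_r:=\{i:|q_i|=r\}\ne\emptyset$, $\sum_{i\in F_r}m_iq_i=0$. Homographic motion: $Q(\theta)$ is the rotation by angle $\theta$ about the $z$-axis, and $r(t)>0$, $\theta(t)$ are functions on the time interval of the motion solving $\ddot r-r\dot\theta^2=-\lambda/r^2$, $\frac{d}{dt}[r^2\dot\theta]=0$, where $\lambda$ is the constant of the CC $(q,m)$. The massless particle satisfies Newton's equation $\ddot x_0=\sum_{i=1}^n\frac{m_i(x_i-x_0)}{|x_i-x_0|^3}$ on that interval (in particular, it does not collide with the primaries). Pyramidal central configuration: a CC of $n+1$ points $q_0,\dots,q_n$ in $\mathbb{R}^3$ such that $q_1,\dots,q_n$ lie in a plane and $q_0$ does not lie in that plane. *)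

theory Defs
  imports "HOL-Analysis.Analysis"
begin

text \<open>Gravitational units with constant 1; the bodies are indexed by a finite set \<open>J\<close> of naturals.\<close>

definition newton_force :: "nat set \<Rightarrow> (nat \<Rightarrow> real) \<Rightarrow> (nat \<Rightarrow> real^3) \<Rightarrow> real^3 \<Rightarrow> real^3" where
  "newton_force J m p y = (\<Sum>i\<in>J. (m i / norm (p i - y) ^ 3) *\<^sub>R (p i - y))"

text \<open>The mass-free form of the equations, so that bodies of mass zero are also constrained.
  For positive masses it agrees with \<open>\<nabla>\<^sub>jU + \<lambda> m\<^sub>j q\<^sub>j = 0\<close>, see \<open>cc_with_iff_gradient\<close> below.\<close>

definition cc_with :: "real \<Rightarrow> nat set \<Rightarrow> (nat \<Rightarrow> real) \<Rightarrow> (nat \<Rightarrow> real^3) \<Rightarrow> bool" where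
  "cc_with lam J m q \<longleftrightarrow>
     inj_on q J \<and> (\<forall>j\<in>J. newton_force (J - {j}) m q (q j) = - (lam *\<^sub>R q j))"

definition central_configuration :: "nat set \<Rightarrow> (nat \<Rightarrow> real) \<Rightarrow> (nat \<Rightarrow> real^3) \<Rightarrow> bool" where
  "central_configuration J m q \<longleftrightarrow> (\<exists>lam. cc_with lam J m q)"

definition balanced :: "nat set \<Rightarrow> (nat \<Rightarrow> real) \<Rightarrow> (nat \<Rightarrow> real^3) \<Rightarrow> bool" where
  "balanced J m q \<longleftrightarrow>
     (\<forall>r>0. {i\<in>J. norm (q i) = r} \<noteq> {} \<longrightarrow> (\<Sum>i | i \<in> J \<and> norm (q i) = r. m i *\<^sub>R q i) = 0)"

definition pyramidal_cc :: "nat \<Rightarrow> (nat \<Rightarrow> real) \<Rightarrow> (nat \<Rightarrow> real^3) \<Rightarrow> bool" where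
  "pyramidal_cc n m q \<longleftrightarrow>
     central_configuration {0..n} m q \<and>
     (\<exists>P. affine P \<and> aff_dim P = 2 \<and> q ` {1..n} \<subseteq> P \<and> q 0 \<notin> P)"

definition rot_z :: "real \<Rightarrow> real^3^3" where
  "rot_z a = vector [vector [cos a, - sin a, 0],
                     vector [sin a,   cos a, 0],
                     vector [0,       0,     1]]"

text \<open>Derivatives are taken within the time interval \<open>I\<close>, hence are one-sided at any end point
  that belongs to \<open>I\<close>.\<close>

definition kepler_pair :: "real \<Rightarrow> real set \<Rightarrow> (real \<Rightarrow> real) \<Rightarrow> (real \<Rightarrow> real) \<Rightarrow> bool" where
  "kepler_pair lam I r \<theta> \<longleftrightarrow>
     (\<exists>r' r'' \<theta>'. \<forall>t\<in>I.
        r t > 0 \<and>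
        (r has_real_derivative r' t) (at t within I) \<and>
        (r' has_real_derivative r'' t) (at t within I) \<and>
        (\<theta> has_real_derivative \<theta>' t) (at t within I) \<and>
        r'' t - r t * (\<theta>' t)\<^sup>2 = - lam / (r t)\<^sup>2 \<and>
        ((\<lambda>s. (r s)\<^sup>2 * \<theta>' s) has_real_derivative 0) (at t within I))"

definition homographic_motion ::
    "real \<Rightarrow> nat set \<Rightarrow> (nat \<Rightarrow> real^3) \<Rightarrow> real set \<Rightarrow> (real \<Rightarrow> real) \<Rightarrow> (real \<Rightarrow> real) \<Rightarrow>
      (nat \<Rightarrow> real \<Rightarrow> real^3) \<Rightarrow> bool" where
  "homographic_motion lam J q I r \<theta> x \<longleftrightarrow>
     kepler_pair lam I r \<theta> \<and> (\<forall>j\<in>J. \<forall>t\<in>I. x j t = r t *\<^sub>R (rot_z (\<theta> t) *v q j))"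

definition homothetic_motion ::
    "nat set \<Rightarrow> (nat \<Rightarrow> real^3) \<Rightarrow> real set \<Rightarrow> (real \<Rightarrow> real) \<Rightarrow> (nat \<Rightarrow> real \<Rightarrow> real^3) \<Rightarrow> bool" where
  "homothetic_motion J p I r x \<longleftrightarrow> (\<forall>j\<in>J. \<forall>t\<in>I. x j t = r t *\<^sub>R p j)"

text \<open>The explicit absence of collisions matters because of \<open>1 / 0 = 0\<close>.\<close>

definition test_particle_motion ::
    "nat set \<Rightarrow> (nat \<Rightarrow> real) \<Rightarrow> real set \<Rightarrow> (nat \<Rightarrow> real \<Rightarrow> real^3) \<Rightarrow> (real \<Rightarrow> real^3) \<Rightarrow> bool" where
  "test_particle_motion J m I x y \<longleftrightarrow>
     (\<exists>v. \<forall>t\<in>I.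
        (\<forall>i\<in>J. x i t \<noteq> y t) \<and>
        (y has_vector_derivative v t) (at t within I) \<and>
        (v has_vector_derivative newton_force J m (\<lambda>i. x i t) (y t)) (at t within I))"

definition potential :: "nat set \<Rightarrow> (nat \<Rightarrow> real) \<Rightarrow> (nat \<Rightarrow> real^3) \<Rightarrow> real" where
  "potential J m q = (\<Sum>(i, k) \<in> {(i, k). i \<in> J \<and> k \<in> J \<and> i < k}. m i * m k / norm (q i - q k))"

lemma GDERIV_inverse_distance:
  fixes a b :: "real^3"
  assumes "b \<noteq> a"
  shows "GDERIV (\<lambda>y. c / norm (a - y)) b :> (c / norm (a - b) ^ 3) *\<^sub>R (a - b)"
proof -
  have n: "norm (a - b) \<noteq> 0" using assms by simp
  have "((\<lambda>y. norm (a - y)) has_derivative (\<lambda>h. (- h) \<bullet> sgn (a - b))) (at b)"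
    by (rule has_derivative_compose[of "\<lambda>y. a - y" "\<lambda>h. - h" b UNIV norm "\<lambda>h. h \<bullet> sgn (a - b)"])
      (use assms in \<open>auto intro!: derivative_eq_intros has_derivative_norm simp: inner_commute\<close>)
  from has_derivative_divide[OF has_derivative_const[of c] this n]
  have "((\<lambda>y. c / norm (a - y)) has_derivative
      (\<lambda>h. - c * (inverse (norm (a - b)) * ((- h) \<bullet> sgn (a - b)) * inverse (norm (a - b))) + 0 / norm (a - b))) (at b)"
    by simp
  then show ?thesis
    unfolding gderiv_def
  proof (rule has_derivative_eq_rhs, intro ext)
    fix h :: "real^3"
    have alg: "- c * (inverse k * (- (inverse k * w)) * inverse k) = c / k ^ 3 * w" for k w :: real
      by (simp add: divide_inverse power3_eq_cube)
    have "(- h) \<bullet> sgn (a - b) = - (inverse (norm (a - b)) * (h \<bullet> (a - b)))"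
      by (simp only: sgn_div_norm inner_minus_left inner_scaleR_right)
    then show "- c * (inverse (norm (a - b)) * ((- h) \<bullet> sgn (a - b)) * inverse (norm (a - b)))
        + 0 / norm (a - b) = h \<bullet> (c / norm (a - b) ^ 3) *\<^sub>R (a - b)"
      by (simp only: alg inner_scaleR_right div_0 add_0_right)
  qed
qed

lemma GDERIV_potential:
  fixes q :: "nat \<Rightarrow> real^3"
  assumes "finite J" "inj_on q J" "j \<in> J"
  shows "GDERIV (\<lambda>y. potential J m (q(j := y))) (q j) :> m j *\<^sub>R newton_force (J - {j}) m q (q j)"
proof -
  let ?P = "{(i, k). i \<in> J \<and> k \<in> J \<and> i < k}"
  define G where "G l = (m j * m l / norm (q l - q j) ^ 3) *\<^sub>R (q l - q j)" for l
  define H where "H = (\<lambda>(i, k). if i = j then G k else if k = j then G i else 0)"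
  have finP: "finite ?P"
    by (rule finite_subset[of _ "J \<times> J"]) (use assms in auto)
  have ne: "q j \<noteq> q l" if "l \<in> J" "l \<noteq> j" for l
    using that assms by (auto dest: inj_onD)
  have pair: "((\<lambda>y. case p of (i, k) \<Rightarrow> m i * m k / norm ((q(j := y)) i - (q(j := y)) k))
      has_derivative (\<lambda>h. h \<bullet> H p)) (at (q j))" if p: "p \<in> ?P" for p
  proof -
    obtain i k where ik: "p = (i, k)" "i \<in> J" "k \<in> J" "i < k" using p by auto
    consider "i = j" "k \<noteq> j" | "k = j" "i \<noteq> j" | "i \<noteq> j" "k \<noteq> j" using ik by auto
    then show ?thesis
    proof cases
      case 1
      with GDERIV_inverse_distance[OF ne[of k], of "m j * m k"] ik show ?thesis
        by (simp add: gderiv_def H_def G_def norm_minus_commute)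
    next
      case 2
      with GDERIV_inverse_distance[OF ne[of i], of "m j * m i"] ik show ?thesis
        by (simp add: gderiv_def H_def G_def mult.commute)
    next
      case 3
      then show ?thesis using ik by (simp add: H_def)
    qed
  qed
  have "((\<lambda>y. potential J m (q(j := y))) has_derivative (\<lambda>h. \<Sum>p\<in>?P. h \<bullet> H p)) (at (q j))"
    unfolding potential_def by (rule has_derivative_sum) (rule pair)
  moreover have "(\<Sum>p\<in>?P. H p) = (\<Sum>l\<in>J - {j}. G l)"
  proof -
    have "(\<Sum>p\<in>?P. H p) = (\<Sum>p\<in>{p\<in>?P. fst p = j \<or> snd p = j}. H p)"
      by (rule sum.mono_neutral_right) (use finP in \<open>auto simp: H_def split: if_splits\<close>)
    also have "\<dots> = (\<Sum>l\<in>J - {j}. G l)"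
      by (rule sum.reindex_bij_witness[where i = "\<lambda>l. (min l j, max l j)"
              and j = "\<lambda>p. if fst p = j then snd p else fst p"])
        (use assms in \<open>auto simp: H_def min_def max_def\<close>)
    finally show ?thesis .
  qed
  moreover have "(\<Sum>l\<in>J - {j}. G l) = m j *\<^sub>R newton_force (J - {j}) m q (q j)"
    by (simp add: G_def newton_force_def scaleR_sum_right)
  ultimately show ?thesis
    by (simp add: gderiv_def flip: inner_sum_right)
qed

lemma cc_with_iff_gradient:
  fixes q :: "nat \<Rightarrow> real^3"
  assumes "finite J" "\<forall>j\<in>J. m j > 0"
  shows "cc_with lam J m q \<longleftrightarrow>
    inj_on q J \<and>
    (\<forall>j\<in>J. \<exists>g. (GDERIV (\<lambda>y. potential J m (q(j := y))) (q j) :> g) \<and> g + (lam * m j) *\<^sub>R q j = 0)"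
proof -
  have "newton_force (J - {j}) m q (q j) = - (lam *\<^sub>R q j) \<longleftrightarrow>
      (\<exists>g. (GDERIV (\<lambda>y. potential J m (q(j := y))) (q j) :> g) \<and> g + (lam * m j) *\<^sub>R q j = 0)"
    if inj: "inj_on q J" and j: "j \<in> J" for j
  proof -
    let ?N = "newton_force (J - {j}) m q (q j)"
    have D: "GDERIV (\<lambda>y. potential J m (q(j := y))) (q j) :> m j *\<^sub>R ?N"
      by (rule GDERIV_potential) (use assms inj j in auto)
    have uniq: "g = m j *\<^sub>R ?N" if "GDERIV (\<lambda>y. potential J m (q(j := y))) (q j) :> g" for g
    proof -
      have "(\<lambda>h. h \<bullet> g) = (\<lambda>h. h \<bullet> (m j *\<^sub>R ?N))"
        using has_derivative_unique[OF that[unfolded gderiv_def] D[unfolded gderiv_def]] .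
      then show ?thesis by (meson fun_cong vector_eq_ldot)
    qed
    have "m j *\<^sub>R ?N + (lam * m j) *\<^sub>R q j = m j *\<^sub>R (?N + lam *\<^sub>R q j)"
      by (simp add: scaleR_add_right mult.commute)
    moreover have "m j \<noteq> 0" using assms j by force
    ultimately have "m j *\<^sub>R ?N + (lam * m j) *\<^sub>R q j = 0 \<longleftrightarrow> ?N = - (lam *\<^sub>R q j)"
      by (simp add: add_eq_0_iff2)
    with D uniq show ?thesis by blast
  qed
  then show ?thesis unfolding cc_with_def by blast
qed

end

theory Submission
  imports Defs
begin

text \<open>
  By similarity of the Newtonian force, the particle at height \<open>z = c r\<close> feels the force exerted on
  \<open>(0, 0, c)\<close> by the fixed configuration, rotated and scaled by \<open>1 / r\<^sup>2\<close>. Its horizontal part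
  \<open>\<Sum>i. m\<^sub>i (s\<^sub>i\<^sup>2 + c\<^sup>2) powr (- 3 / 2) q\<^sub>i\<close> must vanish. If \<open>c = z / r\<close> were not constant, this would hold
  on an interval of values \<open>c\<^sup>2\<close>, and linear independence of the functions
  \<open>w \<mapsto> (\<alpha> + w) powr (- 3 / 2)\<close> for distinct \<open>\<alpha>\<close> would make the configuration balanced. So \<open>c\<close> is
  constant. If \<open>c = 0\<close>, the horizontal equation is the first alternative. If \<open>c \<noteq> 0\<close>, the vertical
  equation reads \<open>r'' = - \<kappa> / r\<^sup>2\<close> with \<open>\<kappa> > 0\<close>; with the angular momentum \<open>\<omega> = r\<^sup>2 \<theta>'\<close> the radial
  equation becomes \<open>\<omega>\<^sup>2 = (\<lambda> - \<kappa>) r\<close>. If \<open>\<lambda> \<noteq> \<kappa>\<close>, then \<open>r\<close> is constant, contradicting \<open>\<kappa> > 0\<close>. Hence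
  \<open>\<lambda> = \<kappa>\<close> and \<open>\<omega> = 0\<close>, which is the second alternative.
\<close>

section \<open>Linear independence of shifted powers\<close>

lemma sum_shifted_powr_deriv_zero:
  fixes a g :: "'a \<Rightarrow> real"
  assumes e: "e < 0" and pos: "\<And>i. i \<in> J \<Longrightarrow> 0 \<le> a i + u"
    and zero: "\<And>w. w \<in> {u<..<v} \<Longrightarrow> (\<Sum>i\<in>J. g i * (a i + w) powr e) = 0"
    and w: "w \<in> {u<..<v}"
  shows "(\<Sum>i\<in>J. g i * (a i + w) powr (e - real k)) = 0"
  using w
proof (induction k arbitrary: w)
  case 0
  then show ?case using zero by simp
next
  case (Suc k)
  have "((\<lambda>w. \<Sum>i\<in>J. g i * (a i + w) powr (e - real k)) has_real_derivative
      (\<Sum>i\<in>J. g i * ((e - real k) * (a i + w) powr (e - real k - 1)))) (at w)"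
  proof (rule DERIV_sum)
    fix i assume "i \<in> J"
    then have "a i + w > 0" using pos[of i] Suc.prems by auto
    then show "((\<lambda>w. g i * (a i + w) powr (e - real k)) has_real_derivative
        g i * ((e - real k) * (a i + w) powr (e - real k - 1))) (at w)"
      by (auto intro!: derivative_eq_intros)
  qed
  moreover have "((\<lambda>w. \<Sum>i\<in>J. g i * (a i + w) powr (e - real k)) has_real_derivative 0) (at w)"
    by (rule has_field_derivative_transform_within_open[of "\<lambda>_. 0" _ _ "{u<..<v}"])
      (use Suc in auto)
  ultimately have "0 = (\<Sum>i\<in>J. g i * ((e - real k) * (a i + w) powr (e - real k - 1)))"
    by (rule DERIV_unique[symmetric])
  also have "\<dots> = (e - real k) * (\<Sum>i\<in>J. g i * (a i + w) powr (e - real (Suc k)))"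
    by (simp add: sum_distrib_left algebra_simps)
  \<comment> \<open>The factor \<open>e - real k\<close> produced by differentiation is negative
    because \<open>e < 0\<close>, so it cancels.\<close>
  finally show ?case using e by simp
qed

text \<open>Differentiation at one point \<open>w\<close> yields all moments of the nodes \<open>1 / (a i + w)\<close>; a polynomial
  vanishing at every node but one isolates the coefficient of that node.\<close>

lemma shifted_powr_independent:
  fixes a g :: "'a \<Rightarrow> real"
  assumes fin: "finite J" and e: "e < 0" and pos: "\<And>i. i \<in> J \<Longrightarrow> 0 \<le> a i + u" and uv: "u < v"
    and zero: "\<And>w. w \<in> {u<..<v} \<Longrightarrow> (\<Sum>i\<in>J. g i * (a i + w) powr e) = 0"
  shows "(\<Sum>i | i \<in> J \<and> a i = \<alpha>. g i) = 0"
proof (cases "\<alpha> \<in> a ` J")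
  case False
  then have "{i. i \<in> J \<and> a i = \<alpha>} = {}" by auto
  then show ?thesis by (simp only: sum.empty)
next
  case True
  define w where "w = (u + v) / 2"
  have w: "w \<in> {u<..<v}" using uv by (simp add: w_def)
  have b: "a i + w > 0" if "i \<in> J" for i
    using pos[OF that] w by auto
  \<comment> \<open>The exponent \<open>k\<close> stays arbitrary in the induction: inserting
    \<open>\<beta>\<close> adds the factor \<open>1 / (a i + w) - 1 / (\<beta> + w)\<close>, whose
    first term raises \<open>k\<close> by one and whose second term does not depend on
    \<open>i\<close>.\<close>
  have moments: "(\<Sum>i\<in>J. g i * (\<Prod>\<beta>\<in>S. 1 / (a i + w) - 1 / (\<beta> + w)) * (a i + w) powr (e - real k)) = 0"
    if "finite S" for S k
    using that
  proof (induction S arbitrary: k rule: finite_induct)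
    case empty
    then show ?case
      using sum_shifted_powr_deriv_zero[of e J a u v g w k] e pos zero w by simp
  next
    case (insert \<beta> S)
    let ?p = "\<lambda>i k. g i * (\<Prod>\<beta>\<in>S. 1 / (a i + w) - 1 / (\<beta> + w)) * (a i + w) powr (e - real k)"
    have "(\<Sum>i\<in>J. g i * (\<Prod>\<beta>\<in>insert \<beta> S. 1 / (a i + w) - 1 / (\<beta> + w)) * (a i + w) powr (e - real k))
        = (\<Sum>i\<in>J. ?p i (Suc k) - 1 / (\<beta> + w) * ?p i k)"
    proof (rule sum.cong[OF refl])
      fix i assume "i \<in> J"
      then have "(a i + w) powr (e - real (Suc k)) = 1 / (a i + w) * (a i + w) powr (e - real k)"
        using b[of i] powr_diff[of "a i + w" "e - real k" 1] by (simp add: diff_diff_eq add.commute)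
      then show "g i * (\<Prod>\<beta>\<in>insert \<beta> S. 1 / (a i + w) - 1 / (\<beta> + w)) * (a i + w) powr (e - real k)
          = ?p i (Suc k) - 1 / (\<beta> + w) * ?p i k"
        by (simp only: prod.insert[OF insert.hyps] left_diff_distrib right_diff_distrib mult_ac)
    qed
    also have "\<dots> = 0"
      by (simp only: sum_subtractf insert.IH flip: sum_distrib_left)
    finally show ?case .
  qed
  \<comment> \<open>Since \<open>1 / (x + w)\<close> is injective where \<open>x + w > 0\<close>,
    the product \<open>?P\<close> vanishes at every value of \<open>a\<close> except
    \<open>\<alpha>\<close> and is nonzero there.\<close>
  let ?S = "a ` J - {\<alpha>}"
  let ?P = "\<lambda>x. \<Prod>\<beta>\<in>?S. 1 / (x + w) - 1 / (\<beta> + w)"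
  have "0 = (\<Sum>i\<in>J. g i * ?P (a i) * (a i + w) powr e)"
    using moments[of ?S 0] fin by simp
  also have "\<dots> = (\<Sum>i | i \<in> J \<and> a i = \<alpha>. g i * ?P (a i) * (a i + w) powr e)"
  proof (rule sum.mono_neutral_right)
    show "\<forall>i\<in>J - {i \<in> J. a i = \<alpha>}. g i * ?P (a i) * (a i + w) powr e = 0"
    proof
      fix i assume i: "i \<in> J - {i \<in> J. a i = \<alpha>}"
      then have "?P (a i) = 0"
        using fin by (intro prod_zero) auto
      then show "g i * ?P (a i) * (a i + w) powr e = 0" by simp
    qed
  qed (use fin in auto)
  also have "\<dots> = ?P \<alpha> * (\<alpha> + w) powr e * (\<Sum>i | i \<in> J \<and> a i = \<alpha>. g i)"
    by (subst sum_distrib_left, rule sum.cong) auto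
  finally have "?P \<alpha> * (\<alpha> + w) powr e * (\<Sum>i | i \<in> J \<and> a i = \<alpha>. g i) = 0" by simp
  moreover have "\<alpha> + w > 0" using True b by auto
  moreover have "?P \<alpha> \<noteq> 0"
    using fin b \<open>\<alpha> + w > 0\<close> by (force simp: prod_zero_iff)
  ultimately show ?thesis by simp
qed

section \<open>Rotations about the vertical axis and symmetries of the Newtonian force\<close>

lemma rot_z_mult_nth:
  "(rot_z a *v x) $ 1 = cos a * x $ 1 - sin a * x $ 2"
  "(rot_z a *v x) $ 2 = sin a * x $ 1 + cos a * x $ 2"
  "(rot_z a *v x) $ 3 = x $ 3"
  by (simp_all add: rot_z_def matrix_vector_mult_def sum_3)

lemma norm_power2_3: "norm x ^ 2 = (x $ 1)\<^sup>2 + (x $ 2)\<^sup>2 + (x $ 3)\<^sup>2" for x :: "real^3"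
  by (simp only: power2_norm_eq_inner inner_vec_def sum_3) (simp add: power2_eq_square)

lemma norm_rot_z_mult [simp]: "norm (rot_z a *v x) = norm x"
proof -
  have "(norm (rot_z a *v x))\<^sup>2 = ((cos a)\<^sup>2 + (sin a)\<^sup>2) * ((x $ 1)\<^sup>2 + (x $ 2)\<^sup>2) + (x $ 3)\<^sup>2"
    unfolding norm_power2_3 rot_z_mult_nth by algebra
  then have "(norm (rot_z a *v x))\<^sup>2 = (norm x)\<^sup>2"
    by (simp add: norm_power2_3)
  then show ?thesis by simp
qed

lemma rot_z_fixes_axis [simp]: "rot_z a *v vector [0, 0, c] = vector [0, 0, c]"
  by (simp add: vec_eq_iff forall_3 rot_z_mult_nth)

text \<open>A rotation about the axis preserves the length of the horizontal part.\<close>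

lemma rot_z_horizontal_zeroD:
  assumes "(rot_z a *v x) $ 1 = 0" "(rot_z a *v x) $ 2 = 0"
  shows "x $ 1 = 0" "x $ 2 = 0"
proof -
  have "(cos a * x $ 1 - sin a * x $ 2)\<^sup>2 + (sin a * x $ 1 + cos a * x $ 2)\<^sup>2
      = ((cos a)\<^sup>2 + (sin a)\<^sup>2) * ((x $ 1)\<^sup>2 + (x $ 2)\<^sup>2)" by algebra
  with assms have "(x $ 1)\<^sup>2 + (x $ 2)\<^sup>2 = 0"
    by (simp add: rot_z_mult_nth)
  then show "x $ 1 = 0" "x $ 2 = 0" by (simp_all add: sum_power2_eq_zero_iff)
qed

lemma newton_force_cong:
  "(\<And>i. i \<in> J \<Longrightarrow> p i = p' i) \<Longrightarrow> newton_force J m p y = newton_force J m p' y"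
  by (simp add: newton_force_def)

text \<open>The force commutes with rotations and is homogeneous of degree -2: one factor
  \<open>r\<close> from the difference against \<open>r ^ 3\<close> from the distance.\<close>

lemma newton_force_similarity:
  assumes "r > 0"
  shows "newton_force J m (\<lambda>i. r *\<^sub>R (rot_z a *v q i)) (r *\<^sub>R (rot_z a *v p))
    = (1 / r\<^sup>2) *\<^sub>R (rot_z a *v newton_force J m q p)"
proof -
  have "(m i / norm (r *\<^sub>R (rot_z a *v q i) - r *\<^sub>R (rot_z a *v p)) ^ 3) *\<^sub>R
      (r *\<^sub>R (rot_z a *v q i) - r *\<^sub>R (rot_z a *v p))
    = (1 / r\<^sup>2) *\<^sub>R (rot_z a *v ((m i / norm (q i - p) ^ 3) *\<^sub>R (q i - p)))" for i
  proof -
    have *: "r *\<^sub>R (rot_z a *v q i) - r *\<^sub>R (rot_z a *v p) = r *\<^sub>R (rot_z a *v (q i - p))"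
      by (simp add: matrix_vector_mult_diff_distrib scaleR_diff_right)
    have "norm (r *\<^sub>R (rot_z a *v (q i - p))) = r * norm (q i - p)"
      using assms by simp
    \<comment> \<open>For \<open>N = 0\<close> both sides are 0 by the convention for
      division.\<close>
    moreover have "m i / (r * N) ^ 3 * r = 1 / r\<^sup>2 * (m i / N ^ 3)" for N
      using assms by (simp add: power_mult_distrib power2_eq_square power3_eq_cube)
    ultimately show ?thesis
      unfolding * by (simp only: scaleR_scaleR matrix_vector_mult_scaleR)
  qed
  then show ?thesis
    by (simp add: newton_force_def scaleR_sum_right linear_sum[OF matrix_vector_mul_linear])
qed

lemma newton_force_massless:
  assumes "m k = 0" "k \<in> J" "finite J"
  shows "newton_force J m p y = newton_force (J - {k}) m p y"
  using assms by (simp add: newton_force_def sum.remove[of J k])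

text \<open>A body of mass zero exerts no force, so the equations of the other bodies persist with
  the same \<open>lam\<close>; the only new equation is the one at \<open>p\<close>.\<close>

lemma cc_with_add_massless:
  assumes cc: "cc_with lam {1..n} m q"
    and ne: "\<And>i. i \<in> {1..n} \<Longrightarrow> q i \<noteq> p"
    and force: "newton_force {1..n} m q p = - (lam *\<^sub>R p)"
  shows "cc_with lam {0..n} (m(0 := 0)) (q(0 := p))"
proof -
  have ins: "{0..n} = insert 0 {1..n}" by auto
  have "inj_on (q(0 := p)) {0..n}"
  proof -
    have "inj_on (q(0 := p)) {1..n}"
      by (rule inj_on_fun_updI) (use cc ne in \<open>unfold cc_with_def, blast+\<close>)
    then show ?thesis
      unfolding ins using ne by force
  qed
  moreover have "newton_force ({0..n} - {j}) (m(0 := 0)) (q(0 := p)) ((q(0 := p)) j)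
      = - (lam *\<^sub>R (q(0 := p)) j)" if j: "j \<in> {0..n}" for j
  proof (cases "j = 0")
    case True
    have "{0..n} - {0} = {1..n}" by auto
    with True force show ?thesis by (simp add: newton_force_def)
  next
    case False
    then have "newton_force ({0..n} - {j}) (m(0 := 0)) (q(0 := p)) (q j)
        = newton_force ({0..n} - {j} - {0}) (m(0 := 0)) (q(0 := p)) (q j)"
      by (intro newton_force_massless) auto
    also have "{0..n} - {j} - {0} = {1..n} - {j}" by auto
    also have "newton_force ({1..n} - {j}) (m(0 := 0)) (q(0 := p)) (q j)
        = newton_force ({1..n} - {j}) m q (q j)"
      by (simp add: newton_force_def)
    also have "\<dots> = - (lam *\<^sub>R q j)"
      using cc False j by (simp add: cc_with_def)
    finally show ?thesis
      unfolding fun_upd_other[OF False] .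
  qed
  ultimately show ?thesis by (simp add: cc_with_def)
qed

text \<open>Equations of motion hold only on \<open>I\<close>, with one-sided derivatives at its end
  points. Identities valid on \<open>I\<close> are therefore differentiated within \<open>I\<close>,
  where a nontrivial filter makes the derivative unique.\<close>

lemma real_derivative_unique_on:
  fixes f g :: "real \<Rightarrow> real"
  assumes "t \<in> I" "at t within I \<noteq> bot" "\<And>s. s \<in> I \<Longrightarrow> f s = g s"
    and "(f has_real_derivative A) (at t within I)" "(g has_real_derivative B) (at t within I)"
  shows "A = B"
  using assms vector_derivative_unique_within has_vector_derivative_transform
  unfolding has_real_derivative_iff_has_vector_derivative by metis

lemma has_real_derivative_vec_nth:
  "(f has_vector_derivative D) (at t within I) \<Longrightarrow>
    ((\<lambda>s. f s $ k) has_real_derivative D $ k) (at t within I)"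
  for f :: "real \<Rightarrow> real^'n"
  unfolding has_real_derivative_iff_has_vector_derivative
  by (rule bounded_linear.has_vector_derivative[OF bounded_linear_vec_nth])

section \<open>Force exerted on the axis by a planar configuration\<close>

lemma norm_diff_axis:
  assumes "(x :: real^3) $ 3 = 0"
  shows "(norm (x - vector [0, 0, c]))\<^sup>2 = (norm x)\<^sup>2 + c\<^sup>2"
  using assms by (simp add: norm_power2_3)

lemma horizontal_plane:
  "affine {x :: real^3. x $ 3 = 0}" "aff_dim {x :: real^3. x $ 3 = 0} = 2"
proof -
  have eq: "{x :: real^3. x $ 3 = 0} = {x. axis 3 1 \<bullet> x = 0}"
    by (simp add: inner_axis inner_commute)
  show "affine {x :: real^3. x $ 3 = 0}" unfolding eq by (rule affine_hyperplane)
  have "axis 3 (1::real) \<noteq> (0 :: real^3)" by simp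
  then show "aff_dim {x :: real^3. x $ 3 = 0} = 2"
    unfolding eq by (simp add: aff_dim_hyperplane)
qed

text \<open>With \<open>w = c\<^sup>2\<close>, a horizontal component of the force is a combination
  of the functions \<open>((norm (q i))\<^sup>2 + w) powr (- 3 / 2)\<close> with coefficients
  \<open>m i * q i $ k\<close>. Independence makes the coefficients on each circle about the origin
  sum to zero.\<close>

lemma balanced_if_axis_force_vertical:
  fixes q :: "nat \<Rightarrow> real^3"
  assumes fin: "finite J" and planar: "\<forall>i\<in>J. q i $ 3 = 0" and c: "c1 < c2"
    and force: "\<And>c. c \<in> {c1<..<c2} \<Longrightarrow> newton_force J m q (vector [0, 0, c]) $ 1 = 0
      \<and> newton_force J m q (vector [0, 0, c]) $ 2 = 0"
  shows "balanced J m q"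
proof -
  \<comment> \<open>If \<open>c2 > 0\<close>, the heights above \<open>max c1 0\<close> serve;
    otherwise all heights are negative and squaring reverses their order.\<close>
  obtain u v where uv: "0 \<le> u" "u < v"
    and sq: "\<And>w. w \<in> {u<..<v} \<Longrightarrow> \<exists>c\<in>{c1<..<c2}. c\<^sup>2 = w"
  proof (cases "c2 > 0")
    case True
    define d where "d = max c1 0"
    show ?thesis
    proof
      show "0 \<le> d\<^sup>2" by simp
      show "d\<^sup>2 < c2\<^sup>2" using c True by (intro power_strict_mono) (auto simp: d_def)
      fix w assume w: "w \<in> {d\<^sup>2<..<c2\<^sup>2}"
      then have w0: "w \<ge> 0" by (meson greaterThanLessThan_iff le_less_trans less_imp_le zero_le_power2)
      have "d < sqrt w" "sqrt w < c2"
        using w True by (auto intro: real_less_rsqrt real_less_lsqrt)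
      then show "\<exists>c\<in>{c1<..<c2}. c\<^sup>2 = w"
        using w0 by (intro bexI[of _ "sqrt w"]) (auto simp: d_def)
    qed
  next
    case False
    show ?thesis
    proof
      show "0 \<le> c2\<^sup>2" by simp
      show "c2\<^sup>2 < c1\<^sup>2" using c False power_strict_mono[of "- c2" "- c1" 2] by simp
      fix w assume w: "w \<in> {c2\<^sup>2<..<c1\<^sup>2}"
      then have w0: "w \<ge> 0" by (meson greaterThanLessThan_iff le_less_trans less_imp_le zero_le_power2)
      have "- c2 < sqrt w" "sqrt w < - c1"
        using w False c by (auto intro!: real_less_rsqrt real_less_lsqrt)
      then show "\<exists>c\<in>{c1<..<c2}. c\<^sup>2 = w"
        using w0 by (intro bexI[of _ "- sqrt w"]) auto
    qed
  qed
  have comp: "(\<Sum>i | i \<in> J \<and> (norm (q i))\<^sup>2 = \<alpha>. m i * q i $ k) = 0" if k: "k = 1 \<or> k = 2" for k :: 3 and \<alpha>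
  proof (rule shifted_powr_independent[where e = "- 3 / 2", OF fin _ _ uv(2)])
    fix w assume w: "w \<in> {u<..<v}"
    then obtain c where c: "c \<in> {c1<..<c2}" "c\<^sup>2 = w" using sq by blast
    have "m i * q i $ k * ((norm (q i))\<^sup>2 + w) powr (- 3 / 2)
        = ((m i / norm (q i - vector [0, 0, c]) ^ 3) *\<^sub>R (q i - vector [0, 0, c])) $ k"
      if i: "i \<in> J" for i
    proof -
      let ?N = "norm (q i - vector [0, 0, c])"
      have N: "?N\<^sup>2 = (norm (q i))\<^sup>2 + w" using norm_diff_axis planar i c by auto
      \<comment> \<open>Because \<open>w > u \<ge> 0\<close>, the distance is positive even for a
        primary at the origin.\<close>
      have "?N\<^sup>2 > 0" unfolding N using w uv by (simp add: add_nonneg_pos)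
      then have "?N > 0" by simp
      then have "(?N\<^sup>2) powr (- 3 / 2) = 1 / ?N ^ 3"
        using powr_powr[of ?N 2 "- 3 / 2"] powr_minus_divide[of ?N 3] by (simp add: powr_numeral)
      then show ?thesis using k N by auto
    qed
    then have "(\<Sum>i\<in>J. m i * q i $ k * ((norm (q i))\<^sup>2 + w) powr (- 3 / 2))
        = newton_force J m q (vector [0, 0, c]) $ k"
      by (simp add: newton_force_def cong: sum.cong)
    also have "\<dots> = 0" using force[OF c(1)] k by auto
    finally show "(\<Sum>i\<in>J. m i * q i $ k * ((norm (q i))\<^sup>2 + w) powr (- 3 / 2)) = 0" .
  qed (use uv in auto)
  show ?thesis
    unfolding balanced_def
  proof (intro allI impI)
    fix r :: real assume r: "r > 0"
    then have *: "{i. i \<in> J \<and> norm (q i) = r} = {i. i \<in> J \<and> (norm (q i))\<^sup>2 = r\<^sup>2}" by auto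
    have "(\<Sum>i | i \<in> J \<and> (norm (q i))\<^sup>2 = r\<^sup>2. m i *\<^sub>R q i) $ k = 0" for k
      using exhaust_3[of k] comp[of k "r\<^sup>2"] planar by auto
    then show "(\<Sum>i | i \<in> J \<and> norm (q i) = r. m i *\<^sub>R q i) = 0"
      unfolding * vec_eq_iff by simp
  qed
qed

theorem theorem7:
  fixes n :: nat and m :: "nat \<Rightarrow> real" and q :: "nat \<Rightarrow> real^3" and lam :: real
    and I :: "real set" and r \<theta> z :: "real \<Rightarrow> real" and x :: "nat \<Rightarrow> real \<Rightarrow> real^3"
  assumes n: "n \<ge> 2"
    and mass: "\<forall>i\<in>{1..n}. m i > 0"
    and center_of_mass: "(\<Sum>i\<in>{1..n}. m i *\<^sub>R q i) = 0"
    and planar: "\<forall>i\<in>{1..n}. q i $ 3 = 0"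
    and cc: "cc_with lam {1..n} m q"
    and non_balanced: "\<not> balanced {1..n} m q"
    and interval: "is_interval I" "interior I \<noteq> {}"
    and primaries: "homographic_motion lam {1..n} q I r \<theta> x"
    and on_axis: "\<forall>t\<in>I. x 0 t = vector [0, 0, z t]"
    and particle: "test_particle_motion {1..n} m I x (x 0)"
  shows "((\<forall>t\<in>I. z t = 0)
          \<and> (\<Sum>i\<in>{1..n}. (m i / norm (q i) ^ 3) *\<^sub>R q i) = 0
          \<and> central_configuration {0..n} (m(0 := 0)) (q(0 := 0)))
       \<or> (\<exists>\<theta>0 c. (\<forall>t\<in>I. \<theta> t = \<theta>0)
          \<and> (\<forall>t\<in>I. z t = c * r t)
          \<and> homothetic_motion {0..n} (\<lambda>j. rot_z \<theta>0 *v (q(0 := vector [0, 0, c])) j) I r x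
          \<and> pyramidal_cc n (m(0 := 0)) (q(0 := vector [0, 0, c])))"
proof -

  \<comment> \<open>Equations of motion in the rotating and rescaled frame\<close>
  have "kepler_pair lam I r \<theta>"
    and x: "\<And>j t. j \<in> {1..n} \<Longrightarrow> t \<in> I \<Longrightarrow> x j t = r t *\<^sub>R (rot_z (\<theta> t) *v q j)"
    using primaries unfolding homographic_motion_def by blast+
  then obtain r' r'' \<theta>' where kepler: "\<forall>t\<in>I. r t > 0 \<and>
      (r has_real_derivative r' t) (at t within I) \<and>
      (r' has_real_derivative r'' t) (at t within I) \<and>
      (\<theta> has_real_derivative \<theta>' t) (at t within I) \<and>
      r'' t - r t * (\<theta>' t)\<^sup>2 = - lam / (r t)\<^sup>2 \<and>
      ((\<lambda>s. (r s)\<^sup>2 * \<theta>' s) has_real_derivative 0) (at t within I)"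
    unfolding kepler_pair_def by (elim exE)
  have K: "\<And>t. t \<in> I \<Longrightarrow> r t > 0"
      "\<And>t. t \<in> I \<Longrightarrow> (r has_real_derivative r' t) (at t within I)"
      "\<And>t. t \<in> I \<Longrightarrow> (r' has_real_derivative r'' t) (at t within I)"
      "\<And>t. t \<in> I \<Longrightarrow> (\<theta> has_real_derivative \<theta>' t) (at t within I)"
      "\<And>t. t \<in> I \<Longrightarrow> r'' t - r t * (\<theta>' t)\<^sup>2 = - lam / (r t)\<^sup>2"
      "\<And>t. t \<in> I \<Longrightarrow> ((\<lambda>s. (r s)\<^sup>2 * \<theta>' s) has_real_derivative 0) (at t within I)"
    using kepler by blast+
  obtain v where particle': "\<forall>t\<in>I. (\<forall>i\<in>{1..n}. x i t \<noteq> x 0 t) \<and>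
      (x 0 has_vector_derivative v t) (at t within I) \<and>
      (v has_vector_derivative newton_force {1..n} m (\<lambda>i. x i t) (x 0 t)) (at t within I)"
    using particle unfolding test_particle_motion_def by (elim exE)
  have V: "\<And>t i. t \<in> I \<Longrightarrow> i \<in> {1..n} \<Longrightarrow> x i t \<noteq> x 0 t"
      "\<And>t. t \<in> I \<Longrightarrow> (x 0 has_vector_derivative v t) (at t within I)"
      "\<And>t. t \<in> I \<Longrightarrow>
        (v has_vector_derivative newton_force {1..n} m (\<lambda>i. x i t) (x 0 t)) (at t within I)"
    using particle' by blast+
  have convex: "convex I" and conn: "connected I"
    using interval(1) is_interval_convex is_interval_connected by blast+
  \<comment> \<open>A connected set with more than one point has no isolated point.\<close>
  have nontriv: "at t within I \<noteq> bot" if "t \<in> I" for t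
  proof -
    have "I \<noteq> {t}" using interval(2) by auto
    then show ?thesis
      using connected_imp_perfect[OF conn that] that trivial_limit_within by blast
  qed
  obtain t0 where t0: "t0 \<in> I" using interval(2) interior_subset by blast
  \<comment> \<open>This is the height in the frame where the primaries rest at \<open>q\<close>;
    the rotation fixes the axis, so only the scaling by \<open>r t\<close> acts on it.\<close>
  define c where "c t = z t / r t" for t
  let ?p = "\<lambda>c. vector [0, 0, c] :: real^3"
  let ?F = "\<lambda>c. newton_force {1..n} m q (?p c)"
  have x0: "x 0 t = r t *\<^sub>R (rot_z (\<theta> t) *v ?p (c t))" if "t \<in> I" for t
    using on_axis K(1) that by (simp add: c_def vec_eq_iff forall_3 less_imp_neq[symmetric])
  have force: "newton_force {1..n} m (\<lambda>i. x i t) (x 0 t)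
      = (1 / (r t)\<^sup>2) *\<^sub>R (rot_z (\<theta> t) *v ?F (c t))" if t: "t \<in> I" for t
  proof -
    have "newton_force {1..n} m (\<lambda>i. x i t) (x 0 t)
        = newton_force {1..n} m (\<lambda>i. r t *\<^sub>R (rot_z (\<theta> t) *v q i)) (x 0 t)"
      using x t by (intro newton_force_cong) auto
    then show ?thesis
      unfolding x0[OF t] newton_force_similarity[OF K(1)[OF t]] .
  qed
  have dx0: "((\<lambda>s. x 0 s $ k) has_real_derivative v t $ k) (at t within I)"
    and dv: "((\<lambda>s. v s $ k) has_real_derivative
      ((1 / (r t)\<^sup>2) *\<^sub>R (rot_z (\<theta> t) *v ?F (c t))) $ k) (at t within I)" if "t \<in> I" for t k
    using has_real_derivative_vec_nth[OF V(2)[OF that]] has_real_derivative_vec_nth[OF V(3)[OF that]]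
    unfolding force[OF that] by auto
  \<comment> \<open>The particle stays on the axis, so its horizontal velocity and acceleration
    vanish; the rotation and the factor \<open>1 / (r t)\<^sup>2\<close> are invertible.\<close>
  have horizontal: "?F (c t) $ 1 = 0 \<and> ?F (c t) $ 2 = 0" if t: "t \<in> I" for t
  proof -
    have "(rot_z (\<theta> t) *v ?F (c t)) $ k = 0" if k: "k = 1 \<or> k = 2" for k
    proof -
      have "v s $ k = 0" if s: "s \<in> I" for s
        by (rule real_derivative_unique_on[OF s nontriv[OF s] _ dx0[OF s] DERIV_const])
          (use on_axis k in auto)
      then have "((1 / (r t)\<^sup>2) *\<^sub>R (rot_z (\<theta> t) *v ?F (c t))) $ k = 0"
        by (rule real_derivative_unique_on[OF t nontriv[OF t] _ dv[OF t] DERIV_const])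
      then show ?thesis using K(1)[OF t] by simp
    qed
    then show ?thesis using rot_z_horizontal_zeroD[of "\<theta> t" "?F (c t)"] by simp
  qed
  have zx: "z t = x 0 t $ 3" if "t \<in> I" for t using on_axis that by simp
  have dz: "(z has_real_derivative v t $ 3) (at t within I)" if t: "t \<in> I" for t
    using has_vector_derivative_transform[of t I z "\<lambda>s. x 0 s $ 3", OF t zx] dx0[OF t]
    unfolding has_real_derivative_iff_has_vector_derivative by blast
  have "continuous_on I c"
    unfolding c_def using K(1) DERIV_continuous_on[OF dz] DERIV_continuous_on[OF K(2)]
    by (intro continuous_on_divide) force+
  then have image: "connected (c ` I)" using conn by (rule connected_continuous_image)
  \<comment> \<open>Two different values of \<open>c\<close> would, by continuity, give a whole
    interval of heights with vertical force.\<close>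
  have const: "\<not> c t1 < c t2" if "t1 \<in> I" "t2 \<in> I" for t1 t2
  proof
    assume less: "c t1 < c t2"
    have "balanced {1..n} m q"
    proof (rule balanced_if_axis_force_vertical[OF _ planar less])
      fix d assume "d \<in> {c t1<..<c t2}"
      then have "d \<in> c ` I"
        using connectedD_interval[OF image, of "c t1" "c t2" d] that by auto
      then show "?F d $ 1 = 0 \<and> ?F d $ 2 = 0" using horizontal by blast
    qed simp
    with non_balanced show False ..
  qed
  define c0 where "c0 = c t0"
  have c0: "c t = c0" if "t \<in> I" for t
    using const[OF that t0] const[OF t0 that] by (simp add: c0_def)
  have z: "z t = c0 * r t" if "t \<in> I" for t
    using c0[OF that] K(1)[OF that] by (simp add: c_def field_simps)
  \<comment> \<open>A coincidence here would be a collision at time \<open>t0\<close>.\<close>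
  have ne: "q i \<noteq> ?p c0" if "i \<in> {1..n}" for i
    using V(1)[OF t0 that] x[OF that t0] x0[OF t0] c0[OF t0] by metis
  \<comment> \<open>The primaries lie at height 0, so the vertical pull is
    \<open>- (\<kappa> * c0)\<close>: \<open>\<kappa>\<close> is the multiplier that the massless
    body sees.\<close>
  define \<kappa> where "\<kappa> = (\<Sum>i\<in>{1..n}. m i / norm (q i - ?p c0) ^ 3)"
  have F: "?F c0 = - (\<kappa> *\<^sub>R ?p c0)"
  proof -
    have "?F c0 $ 3 = (\<Sum>i\<in>{1..n}. m i / norm (q i - ?p c0) ^ 3 * - c0)"
      using planar by (auto simp: newton_force_def intro!: sum.cong)
    then have "?F c0 $ 3 = - (\<kappa> * c0)"
      by (simp add: \<kappa>_def sum_distrib_right sum_negf)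
    moreover have "?F c0 $ 1 = 0" "?F c0 $ 2 = 0" using horizontal[OF t0] c0[OF t0] by auto
    ultimately show ?thesis by (simp add: vec_eq_iff forall_3)
  qed

  \<comment> \<open>The stationary and the homothetic alternative\<close>
  show ?thesis
  proof (cases "c0 = 0")
    case True
    have p0: "?p 0 = 0" by (simp add: vec_eq_iff forall_3)
    \<comment> \<open>At the origin the term \<open>lam *\<^sub>R p\<close> vanishes, so zero force
      is the required equation whatever \<open>lam\<close> is.\<close>
    have "newton_force {1..n} m q 0 = 0" using F True p0 by simp
    then have "(\<Sum>i\<in>{1..n}. (m i / norm (q i) ^ 3) *\<^sub>R q i) = 0"
      "cc_with lam {0..n} (m(0 := 0)) (q(0 := 0))"
      using cc_with_add_massless[OF cc, of 0] ne True p0 by (auto simp: newton_force_def)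
    then show ?thesis
      using z True by (auto simp: central_configuration_def)
  next
    case False
    have "\<kappa> > 0"
      unfolding \<kappa>_def using mass ne n by (intro sum_pos) auto
    have v3: "v t $ 3 = c0 * r' t" if t: "t \<in> I" for t
      by (rule real_derivative_unique_on[OF t nontriv[OF t] z dz[OF t] DERIV_cmult[OF K(2)[OF t]]])
    have r'': "r'' t = - \<kappa> / (r t)\<^sup>2" if t: "t \<in> I" for t
    proof -
      have "((1 / (r t)\<^sup>2) *\<^sub>R (rot_z (\<theta> t) *v ?F (c t))) $ 3 = c0 * r'' t"
        by (rule real_derivative_unique_on[OF t nontriv[OF t] v3 dv[OF t] DERIV_cmult[OF K(3)[OF t]]])
      then have "c0 * r'' t = c0 * (- \<kappa> / (r t)\<^sup>2)"
        unfolding c0[OF t] F by (simp add: rot_z_mult_nth mult.commute)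
      then show ?thesis using False mult_cancel_left by blast
    qed
    obtain \<omega> where \<omega>: "\<And>t. t \<in> I \<Longrightarrow> (r t)\<^sup>2 * \<theta>' t = \<omega>"
      using has_field_derivative_zero_constant[OF convex K(6)] by blast
    \<comment> \<open>Eliminating \<open>r''\<close> from the radial equation leaves
      \<open>r t ^ 3 * (\<theta>' t)\<^sup>2 = lam - \<kappa>\<close>; one more factor
      \<open>r t\<close> turns the left side into \<open>\<omega>\<^sup>2\<close>.\<close>
    have \<omega>2: "\<omega>\<^sup>2 = (lam - \<kappa>) * r t" if t: "t \<in> I" for t
    proof -
      have "r t * (\<theta>' t)\<^sup>2 = (lam - \<kappa>) / (r t)\<^sup>2"
        using K(5)[OF t] r''[OF t] by (simp add: diff_divide_distrib)
      then have "r t ^ 3 * (\<theta>' t)\<^sup>2 = lam - \<kappa>"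
        using K(1)[OF t] by (simp add: field_simps power2_eq_square power3_eq_cube)
      moreover have "\<omega>\<^sup>2 = (r t ^ 3 * (\<theta>' t)\<^sup>2) * r t"
        unfolding \<omega>[OF t, symmetric] by algebra
      ultimately show ?thesis by simp
    qed
    have lam: "lam = \<kappa>"
    proof (rule ccontr)
      assume "lam \<noteq> \<kappa>"
      then have r: "r t = \<omega>\<^sup>2 / (lam - \<kappa>)" if "t \<in> I" for t
        using \<omega>2[OF that] by (simp add: field_simps)
      have "r' t = 0" if t: "t \<in> I" for t
        by (rule real_derivative_unique_on[OF t nontriv[OF t] r K(2)[OF t] DERIV_const])
      then have "r'' t0 = 0"
        by (rule real_derivative_unique_on[OF t0 nontriv[OF t0] _ K(3)[OF t0] DERIV_const])
      then show False using r''[OF t0] \<open>\<kappa> > 0\<close> K(1)[OF t0] by simp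
    qed
    then have "\<theta>' t = 0" if "t \<in> I" for t
      using \<omega>2[OF that] \<omega>[OF that] K(1)[OF that] by simp
    then have "\<And>t. t \<in> I \<Longrightarrow> (\<theta> has_real_derivative 0) (at t within I)" using K(4) by metis
    then obtain \<theta>0 where \<theta>: "\<And>t. t \<in> I \<Longrightarrow> \<theta> t = \<theta>0"
      using has_field_derivative_zero_constant[OF convex] by blast
    have "homothetic_motion {0..n} (\<lambda>j. rot_z \<theta>0 *v (q(0 := ?p c0)) j) I r x"
      unfolding homothetic_motion_def
    proof (intro ballI)
      fix j t assume "j \<in> {0..n}" and t: "t \<in> I"
      then show "x j t = r t *\<^sub>R (rot_z \<theta>0 *v (q(0 := ?p c0)) j)"
        using x[of j t] x0[OF t] c0[OF t] \<theta>[OF t] by (cases "j = 0") auto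
    qed
    \<comment> \<open>The equality \<open>lam = \<kappa>\<close> gives the massless body the same
      multiplier as the primaries.\<close>
    moreover have "cc_with lam {0..n} (m(0 := 0)) (q(0 := ?p c0))"
      using cc_with_add_massless[OF cc ne] F lam by simp
    moreover have "(q(0 := ?p c0)) ` {1..n} \<subseteq> {y. y $ 3 = 0}" "(q(0 := ?p c0)) 0 \<notin> {y. y $ 3 = 0}"
      using planar False by auto
    ultimately have "homothetic_motion {0..n} (\<lambda>j. rot_z \<theta>0 *v (q(0 := ?p c0)) j) I r x"
      "pyramidal_cc n (m(0 := 0)) (q(0 := ?p c0))"
      using horizontal_plane unfolding pyramidal_cc_def central_configuration_def by blast+
    with \<theta> z show ?thesis by blast
  qed
qed

end
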